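(* Let $i\in\{1,\dots,M\}$ and $k\in\{1,\dots,q_i\}$, and let $c_j\in\mathbb{R}^{n_j}$ and $\alpha_j\ge0$ for $j\in\{1,\dots,M\}$. Denote by $G^k_{\mathcal{N}_i}$ the $k$-th row of $G_{\mathcal{N}_i}$ and by $g^k_{\mathcal{N}_i}$ the $k$-th element of $g_{\mathcal{N}_i}$. Suppose there exist scalars $\tau^k_{ij}\ge0$, $j\in\mathcal{N}_i$, such that the symmetric block matrix $$ \begin{bmatrix} g_{\mathcal{N}_i}^k & G_{\mathcal{N}_i}^k\alpha_{\mathcal{N}_i}^{1/2} & G_{\mathcal{N}_i}^kc_{\mathcal{N}_i}\\ \alpha_{\mathcal{N}_i}^{1/2}(G_{\mathcal{N}_i}^k)^\top & \sum_{j\in\mathcal{N}_i}\tau_{ij}^kP_{ij} & 0\\ c_{\mathcal{N}_i}^\top(G_{\mathcal{N}_i}^k)^\top & 0 & g_{\mathcal{N}_i}^k-\sum_{j\in\mathcal{N}_i}\tau_{ij}^k \end{bmatrix} $$ is positive semidefinite. Then the $k$-th state constraint $G^k_{\mathcal{N}_i}x_{\mathcal{N}_i}\le g^k_{\mathcal{N}_i}$ holds for every $x_{\mathcal{N}_i}\in\mathbb{R}^{n_{N_i}}$ whose components $x_j$, $j\in\mathcal{N}_i$, satisfy $(x_j-c_j)^\top P_j(x_j-c_j)\le\alpha_j$ for all $j\in\mathcal{N}_i$.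
   Context: A system is composed of $M$ subsystems; subsystem $j$ has state $x_j\in\mathbb{R}^{n_j}$. The global state is $x=[x_1^\top,\dots,x_M^\top]^\top\in\mathbb{R}^n$. For each $i$, $\mathcal{N}_i\subseteq\{1,\dots,M\}$ is the set of neighbors of subsystem $i$, with $i\in\mathcal{N}_i$, and $x_{\mathcal{N}_i}\in\mathbb{R}^{n_{N_i}}$ is the concatenation of the $x_j$, $j\in\mathcal{N}_i$ (so $n_{N_i}=\sum_{j\in\mathcal{N}_i}n_j$). $U_j\in\{0,1\}^{n_j\times n}$ and $W_{\mathcal{N}_i}\in\{0,1\}^{n_{N_i}\times n}$ are the selection matrices with $x_j=U_jx$ and $x_{\mathcal{N}_i}=W_{\mathcal{N}_i}x$. Symmetric positive definite matrices $P_j\in\mathbb{R}^{n_j\times n_j}$ are given; the terminal set of subsystem $j$ is the ellipsoid $\{x_j:(x_j-c_j)^\top P_j(x_j-c_j)\le\alpha_j\}$ with center $c_j$ and size $\alpha_j$. The state constraint set of subsystem $i$ is $\{x_{\mathcal{N}_i}\in\mathbb{R}^{n_{N_i}}:G_{\mathcal{N}_i}x_{\mathcal{N}_i}\le g_{\mathcal{N}_i}\}$ (componentwise inequality) with $G_{\mathcal{N}_i}\in\mathbb{R}^{q_i\times n_{N_i}}$, $g_{\mathcal{N}_i}\in\mathbb{R}^{q_i}$; it is assumed to contain the origin in its interior. Notation: $\alpha=\operatorname{diag}(\alpha_1I_{n_1},\dots,\alpha_MI_{n_M})$, $c=[c_1^\top,\dots,c_M^\top]^\top$, $\alpha_{\mathcal{N}_i}=W_{\mathcal{N}_i}\alpha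 W_{\mathcal{N}_i}^\top$ (diagonal, with entrywise square root $\alpha_{\mathcal{N}_i}^{1/2}$ on the diagonal), $c_{\mathcal{N}_i}=W_{\mathcal{N}_i}c$. For $j\in\mathcal{N}_i$, $P_{ij}=W_{\mathcal{N}_i}U_j^\top P_jU_jW_{\mathcal{N}_i}^\top$, i.e. the block-diagonal matrix with block $P_j$ at the position of $x_j$ in $x_{\mathcal{N}_i}$ and zeros elsewhere, so that $s_{\mathcal{N}_i}^\top P_{ij}s_{\mathcal{N}_i}=s_j^\top P_js_j$. *)

theory Defs
  imports "Jordan_Normal_Form.DL_Submatrix"
begin

text \<open>Vectors and matrices are those of \<^theory>\<open>Jordan_Normal_Form.Matrix\<close>, so dimensions are terms and all
  indices start at 0; subsystems are numbered \<open>0, ..., M - 1\<close>, and \<open>n j\<close> is the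
  dimension of subsystem \<open>j\<close>.\<close>

definition symmetric_rmat :: "real mat \<Rightarrow> bool" where
  "symmetric_rmat A \<longleftrightarrow> A\<^sup>T = A"

definition pos_def_mat :: "nat \<Rightarrow> real mat \<Rightarrow> bool" where
  "pos_def_mat d A \<longleftrightarrow> A \<in> carrier_mat d d \<and> symmetric_rmat A \<and>
     (\<forall>x \<in> carrier_vec d. x \<noteq> 0\<^sub>v d \<longrightarrow> x \<bullet> (A *\<^sub>v x) > 0)"

definition pos_semidef_mat :: "nat \<Rightarrow> real mat \<Rightarrow> bool" where
  "pos_semidef_mat d A \<longleftrightarrow> A \<in> carrier_mat d d \<and> symmetric_rmat A \<and>
     (\<forall>x \<in> carrier_vec d. x \<bullet> (A *\<^sub>v x) \<ge> 0)"

text \<open>Interior of a subset of \<open>\<real>\<^sup>d\<close> for the Euclidean metric; the type of vectors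
  carries no topology, because it contains vectors of all dimensions.\<close>

definition interior_vec :: "nat \<Rightarrow> real vec set \<Rightarrow> real vec set" where
  "interior_vec d S = {x \<in> carrier_vec d. \<exists>\<epsilon>>0. \<forall>y \<in> carrier_vec d.
     sqrt ((y - x) \<bullet> (y - x)) < \<epsilon> \<longrightarrow> y \<in> S}"

definition sum_mat :: "nat \<Rightarrow> nat \<Rightarrow> ('i \<Rightarrow> real mat) \<Rightarrow> 'i set \<Rightarrow> real mat" where
  "sum_mat nr nc A I = mat nr nc (\<lambda>(r, s). \<Sum>i\<in>I. A i $$ (r, s))"

definition append_cols :: "real mat \<Rightarrow> real mat \<Rightarrow> real mat" where
  "append_cols A B = (A\<^sup>T @\<^sub>r B\<^sup>T)\<^sup>T"

definition three_block_mat :: "real mat \<Rightarrow> real mat \<Rightarrow> real mat \<Rightarrow> real mat \<Rightarrow> real mat \<Rightarrow>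
    real mat \<Rightarrow> real mat \<Rightarrow> real mat \<Rightarrow> real mat \<Rightarrow> real mat" where
  "three_block_mat A11 A12 A13 A21 A22 A23 A31 A32 A33 =
     four_block_mat A11 (append_cols A12 A13) (A21 @\<^sub>r A31) (four_block_mat A22 A23 A32 A33)"

definition total_dim :: "(nat \<Rightarrow> nat) \<Rightarrow> nat set \<Rightarrow> nat" where
  "total_dim n J = (\<Sum>j\<in>J. n j)"

text \<open>Positions of the entries of \<open>x\<^sub>j\<close> within the global state \<open>x\<close>.\<close>

definition block_ix :: "(nat \<Rightarrow> nat) \<Rightarrow> nat \<Rightarrow> nat set" where
  "block_ix n j = {total_dim n {..<j} ..< total_dim n {..<Suc j}}"

text \<open>The selection matrix of a set of subsystems consists of the corresponding rows of the identity, in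
  increasing order. It is \<open>U\<^sub>j\<close> for the set \<open>{j}\<close>, and \<open>W\<close> for a set of neighbors.\<close>

definition sel_mat :: "(nat \<Rightarrow> nat) \<Rightarrow> nat \<Rightarrow> nat set \<Rightarrow> real mat" where
  "sel_mat n M J = submatrix (1\<^sub>m (total_dim n {..<M})) (\<Union>j\<in>J. block_ix n j) UNIV"

abbreviation (input) U_mat :: "(nat \<Rightarrow> nat) \<Rightarrow> nat \<Rightarrow> nat \<Rightarrow> real mat" where
  "U_mat n M j \<equiv> sel_mat n M {j}"

abbreviation (input) W_mat :: "(nat \<Rightarrow> nat) \<Rightarrow> nat \<Rightarrow> nat set \<Rightarrow> real mat" where
  "W_mat n M J \<equiv> sel_mat n M J"

definition stack_vec :: "nat \<Rightarrow> (nat \<Rightarrow> real vec) \<Rightarrow> real vec" where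
  "stack_vec M c = foldr (\<lambda>j v. c j @\<^sub>v v) [0..<M] vNil"

definition size_mat :: "(nat \<Rightarrow> nat) \<Rightarrow> nat \<Rightarrow> (nat \<Rightarrow> real) \<Rightarrow> real mat" where
  "size_mat n M \<alpha> = diag_block_mat (map (\<lambda>j. \<alpha> j \<cdot>\<^sub>m 1\<^sub>m (n j)) [0..<M])"

definition c_nbr :: "(nat \<Rightarrow> nat) \<Rightarrow> nat \<Rightarrow> nat set \<Rightarrow> (nat \<Rightarrow> real vec) \<Rightarrow> real vec" where
  "c_nbr n M J c = W_mat n M J *\<^sub>v stack_vec M c"

definition \<alpha>_nbr :: "(nat \<Rightarrow> nat) \<Rightarrow> nat \<Rightarrow> nat set \<Rightarrow> (nat \<Rightarrow> real) \<Rightarrow> real mat" where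
  "\<alpha>_nbr n M J \<alpha> = W_mat n M J * size_mat n M \<alpha> * (W_mat n M J)\<^sup>T"

text \<open>The matrix is diagonal and \<open>sqrt 0 = 0\<close>, so the square root can be taken of every
  entry.\<close>

definition \<alpha>_nbr_sqrt :: "(nat \<Rightarrow> nat) \<Rightarrow> nat \<Rightarrow> nat set \<Rightarrow> (nat \<Rightarrow> real) \<Rightarrow> real mat" where
  "\<alpha>_nbr_sqrt n M J \<alpha> = map_mat sqrt (\<alpha>_nbr n M J \<alpha>)"

definition P_nbr :: "(nat \<Rightarrow> nat) \<Rightarrow> nat \<Rightarrow> nat set \<Rightarrow> (nat \<Rightarrow> real mat) \<Rightarrow> nat \<Rightarrow> real mat" where
  "P_nbr n M J P j =
     W_mat n M J * (U_mat n M j)\<^sup>T * P j * U_mat n M j * (W_mat n M J)\<^sup>T"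

text \<open>The component \<open>x\<^sub>j\<close> of a stacked neighborhood vector, for \<open>j \<in> J\<close>:
  the transpose of \<open>W\<close> embeds the vector into the global state space, filling up with zeros.\<close>

definition component :: "(nat \<Rightarrow> nat) \<Rightarrow> nat \<Rightarrow> nat set \<Rightarrow> nat \<Rightarrow> real vec \<Rightarrow> real vec" where
  "component n M J j x = U_mat n M j *\<^sub>v ((W_mat n M J)\<^sup>T *\<^sub>v x)"

definition ellipsoid :: "nat \<Rightarrow> real mat \<Rightarrow> real vec \<Rightarrow> real \<Rightarrow> real vec set" where
  "ellipsoid d P c a = {x \<in> carrier_vec d. (x - c) \<bullet> (P *\<^sub>v (x - c)) \<le> a}"

definition polyhedron :: "nat \<Rightarrow> real mat \<Rightarrow> real vec \<Rightarrow> real vec set" where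
  "polyhedron d G g = {x \<in> carrier_vec d. G *\<^sub>v x \<le> g}"

text \<open>Here \<open>a\<close> is a row of the constraint matrix and \<open>b\<close> the corresponding entry of
  the right-hand side.\<close>

definition lmi_mat :: "(nat \<Rightarrow> nat) \<Rightarrow> nat \<Rightarrow> nat set \<Rightarrow> (nat \<Rightarrow> real mat) \<Rightarrow> (nat \<Rightarrow> real vec) \<Rightarrow>
    (nat \<Rightarrow> real) \<Rightarrow> real vec \<Rightarrow> real \<Rightarrow> (nat \<Rightarrow> real) \<Rightarrow> real mat" where
  "lmi_mat n M J P c \<alpha> a b \<tau> =
    (let d = total_dim n J;
         G = mat_of_rows d [a];
         R = \<alpha>_nbr_sqrt n M J \<alpha>;
         C = mat_of_cols d [c_nbr n M J c]
     in three_block_mat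
          (b \<cdot>\<^sub>m 1\<^sub>m 1) (G * R)                                          (G * C)
          (R * G\<^sup>T)    (sum_mat d d (\<lambda>j. \<tau> j \<cdot>\<^sub>m P_nbr n M J P j) J) (0\<^sub>m d 1)
          (C\<^sup>T * G\<^sup>T)  (0\<^sub>m 1 d)                                        ((b - (\<Sum>j\<in>J. \<tau> j)) \<cdot>\<^sub>m 1\<^sub>m 1))"

end

theory Submission
  imports Defs
begin

text \<open>The proof is the S-procedure. Since \<open>\<alpha>\<^sub>j = 0\<close> forces \<open>x\<^sub>j = c\<^sub>j\<close> by
  definiteness of \<open>P\<^sub>j\<close>, every admissible \<open>x\<close> can be written \<open>x = c + \<alpha>\<^sup>1\<^sup>/\<^sup>2 s\<close> with
  \<open>s\<^sub>j\<^sup>T P\<^sub>j s\<^sub>j \<le> 1\<close> for all neighbors \<open>j\<close>. Evaluating the quadratic form of the block matrix at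
  \<open>(-1, s, 1)\<close> gives \<open>2 (g - G x) + (\<Sum>j. \<tau>\<^sub>j (s\<^sub>j\<^sup>T P\<^sub>j s\<^sub>j - 1)) \<ge> 0\<close>, and the sum is nonpositive.\<close>

subsection \<open>Quadratic forms of block matrices\<close>

lemma append_cols_carrier [simp, intro]:
  assumes "A \<in> carrier_mat nr nc1" "B \<in> carrier_mat nr nc2"
  shows "append_cols A B \<in> carrier_mat nr (nc1 + nc2)"
  using assms unfolding append_cols_def by auto

text \<open>Side by side, row i of the result is row i of \<open>A\<close> followed by row i of
  \<open>B\<close>, so each scalar product splits at position \<open>nc1\<close>.\<close>

lemma append_cols_mult_vec:
  assumes A: "A \<in> carrier_mat nr nc1" and B: "B \<in> carrier_mat nr nc2"
    and x: "x \<in> carrier_vec nc1" and y: "y \<in> carrier_vec nc2"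
  shows "append_cols A B *\<^sub>v (x @\<^sub>v y) = A *\<^sub>v x + B *\<^sub>v y"
proof (rule eq_vecI)
  fix i assume "i < dim_vec (A *\<^sub>v x + B *\<^sub>v y)"
  then have i: "i < nr" using B by simp
  have "row (append_cols A B) i = row A i @\<^sub>v row B i"
    using A B i by (intro eq_vecI) (auto simp: append_cols_def append_rows_def)
  then show "(append_cols A B *\<^sub>v (x @\<^sub>v y)) $ i = (A *\<^sub>v x + B *\<^sub>v y) $ i"
    using A B x y i carrier_matD(1)[OF append_cols_carrier[OF A B]]
    by (simp add: scalar_prod_append[of _ nc1 _ nc2])
qed (use B carrier_matD(1)[OF append_cols_carrier[OF A B]] in simp)

text \<open>This turns semidefiniteness of the block matrix into a scalar inequality. The matrix is
  a nested 2 by 2 block matrix, so the product is computed for the outer blocks first and then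
  within the lower right one.\<close>

lemma three_block_mat_quadratic_form:
  assumes c: "A11 \<in> carrier_mat n1 n1" "A12 \<in> carrier_mat n1 n2" "A13 \<in> carrier_mat n1 n3"
      "A21 \<in> carrier_mat n2 n1" "A22 \<in> carrier_mat n2 n2" "A23 \<in> carrier_mat n2 n3"
      "A31 \<in> carrier_mat n3 n1" "A32 \<in> carrier_mat n3 n2" "A33 \<in> carrier_mat n3 n3"
    and v: "x \<in> carrier_vec n1" "y \<in> carrier_vec n2" "z \<in> carrier_vec n3"
  shows "(x @\<^sub>v y @\<^sub>v z) \<bullet>
      (three_block_mat A11 A12 A13 A21 A22 A23 A31 A32 A33 *\<^sub>v (x @\<^sub>v y @\<^sub>v z)) =
    x \<bullet> (A11 *\<^sub>v x) + x \<bullet> (A12 *\<^sub>v y) + x \<bullet> (A13 *\<^sub>v z) +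
    y \<bullet> (A21 *\<^sub>v x) + y \<bullet> (A22 *\<^sub>v y) + y \<bullet> (A23 *\<^sub>v z) +
    z \<bullet> (A31 *\<^sub>v x) + z \<bullet> (A32 *\<^sub>v y) + z \<bullet> (A33 *\<^sub>v z)"
proof -
  note m = mult_mat_vec_carrier
  note w = c(1)[THEN m, OF v(1)] c(2)[THEN m, OF v(2)] c(3)[THEN m, OF v(3)]
    c(4)[THEN m, OF v(1)] c(5)[THEN m, OF v(2)] c(6)[THEN m, OF v(3)]
    c(7)[THEN m, OF v(1)] c(8)[THEN m, OF v(2)] c(9)[THEN m, OF v(3)]
  have yz: "y @\<^sub>v z \<in> carrier_vec (n2 + n3)" using v by simp
  have "three_block_mat A11 A12 A13 A21 A22 A23 A31 A32 A33 *\<^sub>v (x @\<^sub>v y @\<^sub>v z) =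
      (A11 *\<^sub>v x + (A12 *\<^sub>v y + A13 *\<^sub>v z)) @\<^sub>v
      ((A21 *\<^sub>v x @\<^sub>v A31 *\<^sub>v x) +
       ((A22 *\<^sub>v y + A23 *\<^sub>v z) @\<^sub>v (A32 *\<^sub>v y + A33 *\<^sub>v z)))"
    unfolding three_block_mat_def
    by (subst four_block_mat_mult_vec[OF c(1) append_cols_carrier[OF c(2,3)]
          carrier_append_rows[OF c(4,7)] four_block_carrier_mat[OF c(5,9)] v(1) yz])
      (simp add: append_cols_mult_vec[OF c(2,3) v(2,3)] mat_mult_append[OF c(4,7) v(1)]
        four_block_mat_mult_vec[OF c(5,6,8,9) v(2,3)])
  \<comment> \<open>Both summands are split after \<open>n2\<close> entries, so they add block by
    block.\<close>
  also have "(A21 *\<^sub>v x @\<^sub>v A31 *\<^sub>v x) +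
       ((A22 *\<^sub>v y + A23 *\<^sub>v z) @\<^sub>v (A32 *\<^sub>v y + A33 *\<^sub>v z)) =
      (A21 *\<^sub>v x + (A22 *\<^sub>v y + A23 *\<^sub>v z)) @\<^sub>v (A31 *\<^sub>v x + (A32 *\<^sub>v y + A33 *\<^sub>v z))"
    using w by (intro append_vec_add) auto
  finally show ?thesis
    using v w by (simp add: scalar_prod_append[of _ n1 _ "n2 + n3"] scalar_prod_append[of _ n2 _ n3]
        scalar_prod_add_distrib[of _ n1] scalar_prod_add_distrib[of _ n2]
        scalar_prod_add_distrib[of _ n3])
qed

text \<open>Used to obtain the terms of the blocks below the diagonal from those above it.\<close>

lemma transpose_form:
  fixes A :: "real mat"
  assumes A: "A \<in> carrier_mat nr nc" and x: "x \<in> carrier_vec nc" and y: "y \<in> carrier_vec nr"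
  shows "x \<bullet> (A\<^sup>T *\<^sub>v y) = y \<bullet> (A *\<^sub>v x)"
proof -
  have "A\<^sup>T *\<^sub>v y \<in> carrier_vec nc" "A *\<^sub>v x \<in> carrier_vec nr" using A x y by auto
  then show ?thesis
    using transpose_vec_mult_scalar[OF A x y] comm_scalar_prod[OF x] comm_scalar_prod[OF y] by simp
qed

lemma quadratic_form_sum:
  fixes A :: "real mat"
  assumes "A \<in> carrier_mat d d" "x \<in> carrier_vec d"
  shows "x \<bullet> (A *\<^sub>v x) = (\<Sum>r<d. \<Sum>s<d. x $ r * (A $$ (r, s) * x $ s))"
  using assms by (simp add: scalar_prod_def sum_distrib_left atLeast0LessThan)

text \<open>The sum of matrices is entrywise, so the claim is an exchange of finite sums: the sum
  over \<open>J\<close> moves outwards past the column index and then past the row index.\<close>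

lemma sum_mat_quadratic_form:
  assumes A: "\<And>j. j \<in> J \<Longrightarrow> A j \<in> carrier_mat d d" and x: "x \<in> carrier_vec d"
  shows "x \<bullet> (sum_mat d d A J *\<^sub>v x) = (\<Sum>j\<in>J. x \<bullet> (A j *\<^sub>v x))"
proof -
  have "x \<bullet> (sum_mat d d A J *\<^sub>v x) =
      (\<Sum>r<d. \<Sum>s<d. \<Sum>j\<in>J. x $ r * (A j $$ (r, s) * x $ s))"
    using x by (subst quadratic_form_sum[of _ d])
      (auto simp: sum_mat_def sum_distrib_left sum_distrib_right)
  also have "\<dots> = (\<Sum>r<d. \<Sum>j\<in>J. \<Sum>s<d. x $ r * (A j $$ (r, s) * x $ s))"
    by (intro sum.cong[OF refl]) (rule sum.swap)
  also have "\<dots> = (\<Sum>j\<in>J. \<Sum>r<d. \<Sum>s<d. x $ r * (A j $$ (r, s) * x $ s))"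
    by (rule sum.swap)
  also have "\<dots> = (\<Sum>j\<in>J. x \<bullet> (A j *\<^sub>v x))"
    using quadratic_form_sum[OF A x] by simp
  finally show ?thesis .
qed

subsection \<open>Positions of the blocks\<close>

text \<open>\<open>sel_mat\<close> keeps the rows of the identity at these positions. Entry r of a
  neighborhood vector therefore belongs to the global position \<open>pick (nbr_ix n J) r\<close>,
  the r-th smallest element counted from 0.\<close>

definition nbr_ix :: "(nat \<Rightarrow> nat) \<Rightarrow> nat set \<Rightarrow> nat set" where
  "nbr_ix n J = (\<Union>j\<in>J. block_ix n j)"

lemma total_dim_lessThan_Suc: "total_dim n {..<Suc j} = total_dim n {..<j} + n j"
  by (simp add: total_dim_def)

lemma total_dim_lessThan_mono: "j \<le> l \<Longrightarrow> total_dim n {..<j} \<le> total_dim n {..<l}"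
  unfolding total_dim_def by (intro sum_mono2) auto

lemma block_ix_iff: "p \<in> block_ix n j \<longleftrightarrow> (\<exists>k<n j. p = total_dim n {..<j} + k)"
  unfolding block_ix_def total_dim_lessThan_Suc
  by (auto simp: nat_le_iff_add)

lemma block_ix_less: "j < M \<Longrightarrow> p \<in> block_ix n j \<Longrightarrow> p < total_dim n {..<M}"
  using total_dim_lessThan_mono[of "Suc j" M n] unfolding block_ix_def by auto

text \<open>Blocks are consecutive half-open intervals: by monotonicity of the partial sums, the one
  with the smaller number ends no later than the other begins.\<close>

lemma block_ix_disjoint: "i \<noteq> j \<Longrightarrow> block_ix n i \<inter> block_ix n j = {}"
  using total_dim_lessThan_mono[of "Suc i" j n] total_dim_lessThan_mono[of "Suc j" i n]
  unfolding block_ix_def by (cases "i < j") auto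

text \<open>The blocks are disjoint intervals of lengths \<open>n j\<close>. This count keeps
  \<open>pick\<close> within its range for all local indices below
  \<open>total_dim n J\<close>.\<close>

lemma card_nbr_ix: "J \<subseteq> {..<M} \<Longrightarrow> card (nbr_ix n J) = total_dim n J"
  unfolding nbr_ix_def
  by (subst card_UN_disjoint)
    (auto simp: total_dim_def block_ix_def total_dim_lessThan_Suc block_ix_disjoint
      finite_subset dest: block_ix_disjoint[of _ _ n, unfolded block_ix_def])

lemma nbr_ix_less: "J \<subseteq> {..<M} \<Longrightarrow> p \<in> nbr_ix n J \<Longrightarrow> p < total_dim n {..<M}"
  unfolding nbr_ix_def using block_ix_less by auto

lemma pick_nbr_ix: "J \<subseteq> {..<M} \<Longrightarrow> r < total_dim n J \<Longrightarrow> pick (nbr_ix n J) r \<in> nbr_ix n J"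
  using pick_in_set_le[of r "nbr_ix n J"] card_nbr_ix by auto

text \<open>\<open>pick\<close> is strictly increasing on indices below the cardinality, so two
  different indices cannot share a value.\<close>

lemma pick_nbr_ix_inj:
  assumes "J \<subseteq> {..<M}" "r < total_dim n J" "s < total_dim n J"
    "pick (nbr_ix n J) r = pick (nbr_ix n J) s"
  shows "r = s"
  using assms pick_mono_le[of s "nbr_ix n J" r] pick_mono_le[of r "nbr_ix n J" s] card_nbr_ix[of J M n]
  by (cases r s rule: linorder_cases) auto

text \<open>The index of p is the number of elements below p. Since p itself is not counted and the
  set is finite, this number is less than the cardinality.\<close>

lemma ex_pick_nbr_ix:
  assumes J: "J \<subseteq> {..<M}" and p: "p \<in> nbr_ix n J"
  obtains r where "r < total_dim n J" "pick (nbr_ix n J) r = p"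
proof (rule that)
  have "nbr_ix n J \<subseteq> {..<total_dim n {..<M}}" using nbr_ix_less[OF J] by blast
  then have "finite (nbr_ix n J)" using finite_subset by blast
  then have "card {a \<in> nbr_ix n J. a < p} < card (nbr_ix n J)"
    using p by (intro psubset_card_mono) auto
  then show "card {a \<in> nbr_ix n J. a < p} < total_dim n J" using card_nbr_ix[OF J] by simp
  show "pick (nbr_ix n J) (card {a \<in> nbr_ix n J. a < p}) = p" using p by (rule pick_card_in_set)
qed

lemma pick_block_ix:
  assumes "k < n j"
  shows "pick (nbr_ix n {j}) k = total_dim n {..<j} + k"
proof -
  have "{a \<in> block_ix n j. a < total_dim n {..<j} + k} = {total_dim n {..<j} ..< total_dim n {..<j} + k}"
    using assms unfolding block_ix_def total_dim_lessThan_Suc by auto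
  moreover have "total_dim n {..<j} + k \<in> block_ix n j" using assms block_ix_iff by auto
  ultimately show ?thesis
    using pick_card_in_set[of "total_dim n {..<j} + k" "block_ix n j"] by (simp add: nbr_ix_def)
qed

subsection \<open>Selection matrices\<close>

text \<open>All positions lie inside the global state, so restricting them to the row range of the
  identity loses none, and row r has its single 1 at the r-th of them.\<close>

lemma sel_mat_eq:
  assumes J: "J \<subseteq> {..<M}"
  shows "sel_mat n M J = mat (total_dim n J) (total_dim n {..<M})
    (\<lambda>(r, p). if pick (nbr_ix n J) r = p then 1 else 0)"
proof -
  have "{p. p < total_dim n {..<M} \<and> p \<in> nbr_ix n J} = nbr_ix n J"
    using nbr_ix_less[OF J] by auto
  then show ?thesis
    unfolding sel_mat_def submatrix_def nbr_ix_def[symmetric]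
    using card_nbr_ix[OF J, of n] pick_nbr_ix[OF J] nbr_ix_less[OF J]
    by (intro eq_matI) (auto simp: pick_UNIV)
qed

lemma sel_mat_carrier [simp, intro]:
  "J \<subseteq> {..<M} \<Longrightarrow> sel_mat n M J \<in> carrier_mat (total_dim n J) (total_dim n {..<M})"
  by (simp add: sel_mat_eq)

lemma row_sel_mat:
  assumes J: "J \<subseteq> {..<M}" and r: "r < total_dim n J"
  shows "row (sel_mat n M J) r = unit_vec (total_dim n {..<M}) (pick (nbr_ix n J) r)"
  using r nbr_ix_less[OF J pick_nbr_ix[OF J r]]
  by (intro eq_vecI) (auto simp: sel_mat_eq[OF J])

lemma sel_mat_mult_vec:
  assumes J: "J \<subseteq> {..<M}" and r: "r < total_dim n J" and x: "x \<in> carrier_vec (total_dim n {..<M})"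
  shows "(sel_mat n M J *\<^sub>v x) $ r = x $ pick (nbr_ix n J) r"
  using r x nbr_ix_less[OF J pick_nbr_ix[OF J r]] sel_mat_carrier[OF J, of n]
  by (auto simp: row_sel_mat[OF J r])

text \<open>The transpose writes entry r back to its global position. As different local indices
  have different positions, only one term of the sum survives.\<close>

lemma transpose_sel_mat_mult_vec:
  assumes J: "J \<subseteq> {..<M}" and r: "r < total_dim n J" and x: "x \<in> carrier_vec (total_dim n J)"
  shows "((sel_mat n M J)\<^sup>T *\<^sub>v x) $ pick (nbr_ix n J) r = x $ r"
proof -
  have p: "pick (nbr_ix n J) r < total_dim n {..<M}"
    using nbr_ix_less[OF J pick_nbr_ix[OF J r]] .
  have "((sel_mat n M J)\<^sup>T *\<^sub>v x) $ pick (nbr_ix n J) r =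
      (\<Sum>s<total_dim n J. (if pick (nbr_ix n J) s = pick (nbr_ix n J) r then 1 else 0) * x $ s)"
    using p x by (simp add: sel_mat_eq[OF J] scalar_prod_def atLeast0LessThan)
  also have "\<dots> = (\<Sum>s<total_dim n J. if s = r then x $ s else 0)"
    using pick_nbr_ix_inj[OF J _ r] by (intro sum.cong) auto
  also have "\<dots> = x $ r" using r by simp
  finally show ?thesis .
qed

text \<open>The rows of the selection matrix are unit vectors, so multiplying from both sides merely
  reads off one entry of \<open>A\<close>.\<close>

lemma sel_mat_conj_index:
  assumes J: "J \<subseteq> {..<M}" and A: "A \<in> carrier_mat (total_dim n {..<M}) (total_dim n {..<M})"
    and r: "r < total_dim n J" and s: "s < total_dim n J"
  shows "(sel_mat n M J * A * (sel_mat n M J)\<^sup>T) $$ (r, s) =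
    A $$ (pick (nbr_ix n J) r, pick (nbr_ix n J) s)"
proof -
  note p = nbr_ix_less[OF J pick_nbr_ix[OF J r]] nbr_ix_less[OF J pick_nbr_ix[OF J s]]
  have "(sel_mat n M J * A * (sel_mat n M J)\<^sup>T) $$ (r, s) =
      row (sel_mat n M J * A) r \<bullet> row (sel_mat n M J) s"
    using r s A sel_mat_carrier[OF J, of n] by (subst index_mult_mat(1)) auto
  also have "\<dots> = (sel_mat n M J * A) $$ (r, pick (nbr_ix n J) s)"
    using r p A sel_mat_carrier[OF J, of n] unfolding row_sel_mat[OF J s]
    by (subst scalar_prod_right_unit) auto
  also have "\<dots> = row (sel_mat n M J) r \<bullet> col A (pick (nbr_ix n J) s)"
    using r p A sel_mat_carrier[OF J, of n] by simp
  also have "\<dots> = A $$ (pick (nbr_ix n J) r, pick (nbr_ix n J) s)"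
    using p A unfolding row_sel_mat[OF J r] by (subst scalar_prod_left_unit) auto
  finally show ?thesis .
qed

subsection \<open>Stacked vectors and sizes\<close>

lemma append_vec_vNil_right: "v @\<^sub>v vNil = v"
  by (intro eq_vecI) auto

lemma stack_vec_Suc: "stack_vec (Suc M) c = stack_vec M c @\<^sub>v c M"
proof -
  \<comment> \<open>The fold splits off the first vector, whereas induction on M must split off the
    last. Generalizing the start value to \<open>w\<close> lets \<open>c M\<close> be moved out at
    the right end.\<close>
  have "foldr (\<lambda>j v. c j @\<^sub>v v) xs w = foldr (\<lambda>j v. c j @\<^sub>v v) xs vNil @\<^sub>v w" for xs w
  proof (induction xs)
    case (Cons j xs)
    then show ?case
      by (intro eq_vecI) auto
  qed simp
  from this[of "[0..<M]" "c M"] show ?thesis by (simp add: stack_vec_def append_vec_vNil_right)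
qed

lemma stack_vec_carrier:
  "(\<And>j. j < M \<Longrightarrow> c j \<in> carrier_vec (n j)) \<Longrightarrow> stack_vec M c \<in> carrier_vec (total_dim n {..<M})"
proof (induction M)
  case 0
  then show ?case by (simp add: stack_vec_def total_dim_def)
next
  case (Suc M)
  then show ?case by (simp add: stack_vec_Suc total_dim_lessThan_Suc)
qed

text \<open>In the induction on M, a position of the last block falls into the appended vector;
  every other position lies below \<open>total_dim n {..<M}\<close> and is covered by the induction
  hypothesis.\<close>

lemma stack_vec_index:
  assumes "\<And>j. j < M \<Longrightarrow> c j \<in> carrier_vec (n j)" "j < M" "k < n j"
  shows "stack_vec M c $ (total_dim n {..<j} + k) = c j $ k"
  using assms
proof (induction M)
  case (Suc M)
  have c: "stack_vec M c \<in> carrier_vec (total_dim n {..<M})" "c M \<in> carrier_vec (n M)"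
    using Suc.prems by (auto intro!: stack_vec_carrier)
  show ?case
  proof (cases "j = M")
    case True
    then show ?thesis using Suc.prems(3) c[THEN carrier_vecD] by (simp add: stack_vec_Suc)
  next
    case False
    then have "total_dim n {..<j} + k < total_dim n {..<M}"
      using Suc.prems block_ix_iff by (intro block_ix_less[of j]) auto
    then show ?thesis using Suc c False by (simp add: stack_vec_Suc)
  qed
qed simp

lemma size_mat_Suc:
  "size_mat n (Suc M) \<alpha> = four_block_mat (size_mat n M \<alpha>)
     (0\<^sub>m (dim_row (size_mat n M \<alpha>)) (n M)) (0\<^sub>m (n M) (dim_col (size_mat n M \<alpha>))) (\<alpha> M \<cdot>\<^sub>m 1\<^sub>m (n M))"
  by (simp add: size_mat_def diag_block_mat_last Let_def)

lemma size_mat_carrier: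
  "size_mat n M \<alpha> \<in> carrier_mat (total_dim n {..<M}) (total_dim n {..<M})"
proof (induction M)
  case 0
  then show ?case by (simp add: size_mat_def total_dim_def)
next
  case (Suc M)
  then show ?case
    by (simp add: size_mat_Suc total_dim_lessThan_Suc)
qed

text \<open>Only the row position is decomposed into block and offset; the column is arbitrary, so
  the zeros off the diagonal are covered too.\<close>

lemma size_mat_index:
  assumes "j < M" "k < n j" "p < total_dim n {..<M}"
  shows "size_mat n M \<alpha> $$ (total_dim n {..<j} + k, p) =
    (if p = total_dim n {..<j} + k then \<alpha> j else 0)"
  using assms
proof (induction M)
  case (Suc M)
  note c = size_mat_carrier[of n M \<alpha>]
  show ?case
  proof (cases "j = M")
    case True
    then show ?thesis using Suc.prems c by (auto simp: size_mat_Suc total_dim_lessThan_Suc)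
  next
    case False
    then have "total_dim n {..<j} + k < total_dim n {..<M}"
      using Suc.prems block_ix_iff by (intro block_ix_less[of j]) auto
    then show ?thesis using Suc c False by (auto simp: size_mat_Suc total_dim_lessThan_Suc)
  qed
qed simp

subsection \<open>Neighborhood vectors\<close>

text \<open>Local index r holds entry k of subsystem j. A relation avoids computing the offset of
  block j among the neighbors; \<open>ex_nbr_pos\<close> and \<open>nbr_pos_cases\<close> translate
  in the two directions.\<close>

definition nbr_pos :: "(nat \<Rightarrow> nat) \<Rightarrow> nat set \<Rightarrow> nat \<Rightarrow> nat \<Rightarrow> nat \<Rightarrow> bool" where
  "nbr_pos n J j k r \<longleftrightarrow> r < total_dim n J \<and> j \<in> J \<and> k < n j \<and>
     pick (nbr_ix n J) r = total_dim n {..<j} + k"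

lemma ex_nbr_pos:
  assumes "J \<subseteq> {..<M}" "j \<in> J" "k < n j"
  obtains r where "nbr_pos n J j k r"
proof -
  have "total_dim n {..<j} + k \<in> nbr_ix n J"
    using assms block_ix_iff[of _ n] by (auto simp: nbr_ix_def)
  then show ?thesis using ex_pick_nbr_ix[OF assms(1)] assms that unfolding nbr_pos_def by metis
qed

lemma nbr_pos_cases:
  assumes "J \<subseteq> {..<M}" "r < total_dim n J"
  obtains j k where "nbr_pos n J j k r"
  using pick_nbr_ix[OF assms] that assms unfolding nbr_ix_def nbr_pos_def by (auto simp: block_ix_iff)

lemma component_carrier:
  assumes "J \<subseteq> {..<M}" "j \<in> J"
  shows "component n M J j x \<in> carrier_vec (n j)"
proof -
  have "sel_mat n M {j} \<in> carrier_mat (n j) (total_dim n {..<M})"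
    using assms sel_mat_carrier[of "{j}" M n] by (auto simp: total_dim_def)
  then show ?thesis unfolding component_def by (intro carrier_vecI) simp
qed

text \<open>The transposed selection matrix of \<open>J\<close> writes entry r to a global position,
  and the selection matrix of \<open>{j}\<close> reads its entry k from the same position.\<close>

lemma component_index:
  assumes J: "J \<subseteq> {..<M}" and pos: "nbr_pos n J j k r" and x: "x \<in> carrier_vec (total_dim n J)"
  shows "component n M J j x $ k = x $ r"
proof -
  have jk: "j \<in> J" "k < n j" "r < total_dim n J" "pick (nbr_ix n J) r = total_dim n {..<j} + k"
    using pos by (auto simp: nbr_pos_def)
  have "(sel_mat n M J)\<^sup>T *\<^sub>v x \<in> carrier_vec (total_dim n {..<M})"
    using sel_mat_carrier[OF J, of n] x by (intro mult_mat_vec_carrier[of _ _ "total_dim n J"]) auto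
  then have "component n M J j x $ k = ((sel_mat n M J)\<^sup>T *\<^sub>v x) $ pick (nbr_ix n {j}) k"
    unfolding component_def using J jk by (intro sel_mat_mult_vec) (auto simp: total_dim_def)
  also have "\<dots> = x $ r"
    using transpose_sel_mat_mult_vec[OF J jk(3) x] jk pick_block_ix[of k n j] by simp
  finally show ?thesis .
qed

lemma c_nbr_carrier: "J \<subseteq> {..<M} \<Longrightarrow> c_nbr n M J c \<in> carrier_vec (total_dim n J)"
  unfolding c_nbr_def by (intro carrier_vecI) (simp add: sel_mat_eq)

lemma c_nbr_index:
  assumes J: "J \<subseteq> {..<M}" and pos: "nbr_pos n J j k r"
    and c: "\<And>j. j < M \<Longrightarrow> c j \<in> carrier_vec (n j)"
  shows "c_nbr n M J c $ r = c j $ k"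
  using pos J stack_vec_index[where c = c and n = n and M = M and j = j and k = k, OF c]
  unfolding c_nbr_def nbr_pos_def
  by (auto simp: sel_mat_mult_vec[OF J _ stack_vec_carrier[OF c]])

lemma \<alpha>_nbr_sqrt_carrier:
  "J \<subseteq> {..<M} \<Longrightarrow> \<alpha>_nbr_sqrt n M J \<alpha> \<in> carrier_mat (total_dim n J) (total_dim n J)"
  unfolding \<alpha>_nbr_sqrt_def \<alpha>_nbr_def by (intro carrier_matI) (simp_all add: sel_mat_eq)

text \<open>The entry comes from \<open>size_mat\<close> at the two picked positions, which coincide
  only for equal local indices; the zeros off the diagonal survive the entrywise root.\<close>

lemma \<alpha>_nbr_sqrt_index:
  assumes J: "J \<subseteq> {..<M}" and pos: "nbr_pos n J j k r" and s: "s < total_dim n J"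
  shows "\<alpha>_nbr_sqrt n M J \<alpha> $$ (r, s) = (if s = r then sqrt (\<alpha> j) else 0)"
proof -
  have jk: "j < M" "k < n j" "r < total_dim n J" "pick (nbr_ix n J) r = total_dim n {..<j} + k"
    using J pos by (auto simp: nbr_pos_def)
  have "\<alpha>_nbr n M J \<alpha> $$ (r, s) =
      (if pick (nbr_ix n J) s = pick (nbr_ix n J) r then \<alpha> j else 0)"
    using nbr_ix_less[OF J pick_nbr_ix[OF J s]] size_mat_index[of j M k n] jk
    unfolding \<alpha>_nbr_def by (subst sel_mat_conj_index[OF J size_mat_carrier jk(3) s]) simp
  then have "\<alpha>_nbr n M J \<alpha> $$ (r, s) = (if s = r then \<alpha> j else 0)"
    using pick_nbr_ix_inj[OF J s jk(3)] by auto
  then show ?thesis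
    using \<alpha>_nbr_sqrt_carrier[OF J, of n \<alpha>] jk s unfolding \<alpha>_nbr_sqrt_def by simp
qed

lemma \<alpha>_nbr_sqrt_transpose:
  assumes J: "J \<subseteq> {..<M}"
  shows "(\<alpha>_nbr_sqrt n M J \<alpha>)\<^sup>T = \<alpha>_nbr_sqrt n M J \<alpha>"
proof (rule eq_matI)
  note R = \<alpha>_nbr_sqrt_carrier[OF J, of n \<alpha>]
  fix r s assume "r < dim_row (\<alpha>_nbr_sqrt n M J \<alpha>)" "s < dim_col (\<alpha>_nbr_sqrt n M J \<alpha>)"
  then have rs: "r < total_dim n J" "s < total_dim n J" using R by auto
  obtain i k where i: "nbr_pos n J i k r" using nbr_pos_cases[OF J rs(1)] .
  obtain j l where j: "nbr_pos n J j l s" using nbr_pos_cases[OF J rs(2)] .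
  show "(\<alpha>_nbr_sqrt n M J \<alpha>)\<^sup>T $$ (r, s) = \<alpha>_nbr_sqrt n M J \<alpha> $$ (r, s)"
    using R rs \<alpha>_nbr_sqrt_index[OF J i rs(2)] \<alpha>_nbr_sqrt_index[OF J j rs(1)]
    by (cases "r = s") simp_all
qed (use \<alpha>_nbr_sqrt_carrier[OF J, of n \<alpha>] in auto)

lemma \<alpha>_nbr_sqrt_mult_vec:
  assumes J: "J \<subseteq> {..<M}" and pos: "nbr_pos n J j k r" and x: "x \<in> carrier_vec (total_dim n J)"
  shows "(\<alpha>_nbr_sqrt n M J \<alpha> *\<^sub>v x) $ r = sqrt (\<alpha> j) * x $ r"
proof -
  have r: "r < total_dim n J" using pos by (simp add: nbr_pos_def)
  have "(\<alpha>_nbr_sqrt n M J \<alpha> *\<^sub>v x) $ r =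
      (\<Sum>s<total_dim n J. \<alpha>_nbr_sqrt n M J \<alpha> $$ (r, s) * x $ s)"
    using r x \<alpha>_nbr_sqrt_carrier[OF J, of n \<alpha>] by (simp add: scalar_prod_def atLeast0LessThan)
  also have "\<dots> = (\<Sum>s<total_dim n J. if s = r then sqrt (\<alpha> j) * x $ s else 0)"
    by (intro sum.cong) (auto simp: \<alpha>_nbr_sqrt_index[OF J pos])
  finally show ?thesis using r by simp
qed

lemma P_nbr_carrier:
  "J \<subseteq> {..<M} \<Longrightarrow> P_nbr n M J P j \<in> carrier_mat (total_dim n J) (total_dim n J)"
  unfolding P_nbr_def by (intro carrier_matI) (simp_all add: sel_mat_eq)

text \<open>With z = \<open>U *\<^sub>v (W\<^sup>T *\<^sub>v x)\<close>, the right factors of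
  \<open>P_nbr\<close> produce z directly, and moving the left factors \<open>W\<close> and
  \<open>U\<^sup>T\<close> to the other side of the scalar product produces z again.\<close>

lemma P_nbr_quadratic_form:
  assumes J: "J \<subseteq> {..<M}" and j: "j \<in> J" and P: "P j \<in> carrier_mat (n j) (n j)"
    and x: "x \<in> carrier_vec (total_dim n J)"
  shows "x \<bullet> (P_nbr n M J P j *\<^sub>v x) = component n M J j x \<bullet> (P j *\<^sub>v component n M J j x)"
proof -
  define D where "D = total_dim n {..<M}"
  define d where "d = total_dim n J"
  define W where "W = sel_mat n M J"
  define U where "U = sel_mat n M {j}"
  have W: "W \<in> carrier_mat d D" and U: "U \<in> carrier_mat (n j) D"
    using J j sel_mat_carrier[of J M n] sel_mat_carrier[of "{j}" M n]
    by (auto simp: W_def U_def d_def D_def total_dim_def)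
  define z where "z = component n M J j x"
  have z: "z \<in> carrier_vec (n j)" "z = U *\<^sub>v (W\<^sup>T *\<^sub>v x)"
    using component_carrier[OF J j] by (auto simp: z_def component_def U_def W_def)
  have x': "x \<in> carrier_vec d" using x by (simp add: d_def)
  have WUP: "W * U\<^sup>T * P j \<in> carrier_mat d (n j)" using W U P by auto
  have WT: "W\<^sup>T *\<^sub>v x \<in> carrier_vec D" using W x' by auto
  have "P_nbr n M J P j *\<^sub>v x = (W * U\<^sup>T * P j * U * W\<^sup>T) *\<^sub>v x"
    by (simp add: P_nbr_def W_def U_def)
  also have "\<dots> = (W * U\<^sup>T * P j * U) *\<^sub>v (W\<^sup>T *\<^sub>v x)"
    using W U WUP x' by (intro assoc_mult_mat_vec[of _ d D _ d]) auto
  also have "\<dots> = (W * U\<^sup>T * P j) *\<^sub>v z"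
    unfolding z(2) using U WUP WT by (intro assoc_mult_mat_vec[of _ d "n j" _ D]) auto
  also have "\<dots> = (W * U\<^sup>T) *\<^sub>v (P j *\<^sub>v z)"
    using W U P z(1) by (intro assoc_mult_mat_vec[of _ d "n j" _ "n j"]) auto
  also have "\<dots> = W *\<^sub>v (U\<^sup>T *\<^sub>v (P j *\<^sub>v z))"
    using W U P z(1) by (intro assoc_mult_mat_vec[of _ d D _ "n j"]) auto
  finally have "x \<bullet> (P_nbr n M J P j *\<^sub>v x) = x \<bullet> (W *\<^sub>v (U\<^sup>T *\<^sub>v (P j *\<^sub>v z)))" by simp
  also have "\<dots> = (W\<^sup>T *\<^sub>v x) \<bullet> (U\<^sup>T *\<^sub>v (P j *\<^sub>v z))"
    using W U P z(1) x' by (intro transpose_vec_mult_scalar[symmetric]) auto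
  also have "\<dots> = (U\<^sup>T *\<^sub>v (P j *\<^sub>v z)) \<bullet> (W\<^sup>T *\<^sub>v x)"
    using W U P z(1) x' by (intro comm_scalar_prod[of _ D]) auto
  also have "\<dots> = (P j *\<^sub>v z) \<bullet> z"
    unfolding z(2) using U P z WT by (intro transpose_vec_mult_scalar[of _ "n j" D]) auto
  also have "\<dots> = z \<bullet> (P j *\<^sub>v z)"
    using P z(1) by (intro comm_scalar_prod[of _ "n j"]) auto
  finally show ?thesis by (simp add: z_def)
qed

section \<open>The quadratic form of the block matrix in the inequality\<close>

lemma lmi_mat_quadratic_form:
  fixes t w :: real
  assumes J: "J \<subseteq> {..<M}" and P: "\<And>j. j \<in> J \<Longrightarrow> P j \<in> carrier_mat (n j) (n j)"
    and a: "a \<in> carrier_vec (total_dim n J)" and u: "u \<in> carrier_vec (total_dim n J)"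
  defines "v \<equiv> vec 1 (\<lambda>_. t) @\<^sub>v u @\<^sub>v vec 1 (\<lambda>_. w)"
  shows "v \<bullet> (lmi_mat n M J P c \<alpha> a b \<tau> *\<^sub>v v) =
    b * t\<^sup>2 + 2 * t * (a \<bullet> (\<alpha>_nbr_sqrt n M J \<alpha> *\<^sub>v u)) + 2 * t * w * (a \<bullet> c_nbr n M J c) +
    (\<Sum>j\<in>J. \<tau> j * (component n M J j u \<bullet> (P j *\<^sub>v component n M J j u))) +
    (b - (\<Sum>j\<in>J. \<tau> j)) * w\<^sup>2"
proof -
  define d where "d = total_dim n J"
  define G where "G = mat_of_rows d [a]"
  define R where "R = \<alpha>_nbr_sqrt n M J \<alpha>"
  define cN where "cN = c_nbr n M J c"
  define C where "C = mat_of_cols d [cN]"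
  define Q where "Q = sum_mat d d (\<lambda>j. \<tau> j \<cdot>\<^sub>m P_nbr n M J P j) J"
  define T where "T = vec 1 (\<lambda>_. t)"
  define Z where "Z = vec 1 (\<lambda>_. w)"
  have a': "a \<in> carrier_vec d" and u': "u \<in> carrier_vec d" using a u by (auto simp: d_def)
  have R: "R \<in> carrier_mat d d" "R\<^sup>T = R"
    using \<alpha>_nbr_sqrt_carrier[OF J] \<alpha>_nbr_sqrt_transpose[OF J] by (auto simp: R_def d_def)
  have cN: "cN \<in> carrier_vec d" using c_nbr_carrier[OF J] by (simp add: cN_def d_def)
  have G: "G \<in> carrier_mat 1 d" and C: "C \<in> carrier_mat d 1" by (auto simp: G_def C_def)
  have TZ: "T \<in> carrier_vec 1" "Z \<in> carrier_vec 1" by (auto simp: T_def Z_def)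
  have Q: "Q \<in> carrier_mat d d" by (simp add: Q_def sum_mat_def)
  have row0: "row G 0 = a" using a' by (simp add: G_def)
  have T_dot: "T \<bullet> y = t * y $ 0" if "y \<in> carrier_vec 1" for y
    using that by (simp add: T_def scalar_prod_def)
  have Z_dot: "Z \<bullet> y = w * y $ 0" if "y \<in> carrier_vec 1" for y
    using that by (simp add: Z_def scalar_prod_def)
  have G_mult: "(G *\<^sub>v y) $ 0 = a \<bullet> y" for y
    using G row0 by simp
  have C_mult: "C *\<^sub>v Z = w \<cdot>\<^sub>v cN"
    using cN C by (intro eq_vecI) (auto simp: Z_def C_def scalar_prod_def mat_of_cols_index)
  have TGR: "T \<bullet> ((G * R) *\<^sub>v u) = t * (a \<bullet> (R *\<^sub>v u))"
    using G R u' by (simp add: T_dot G_mult assoc_mult_mat_vec[OF G R(1) u'])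
  have TGC: "T \<bullet> ((G * C) *\<^sub>v Z) = t * (w * (a \<bullet> cN))"
    using G C TZ a' cN by (simp add: T_dot G_mult C_mult assoc_mult_mat_vec[OF G C TZ(2)])
  \<comment> \<open>The blocks left of the diagonal are the transposes of those above it, here
    because \<open>R\<close> is symmetric. Their terms repeat \<open>TGR\<close> and
    \<open>TGC\<close>, whence the factors 2 in the result.\<close>
  have "R * G\<^sup>T = (G * R)\<^sup>T" using transpose_mult[OF G R(1)] R(2) by simp
  then have uRG: "u \<bullet> ((R * G\<^sup>T) *\<^sub>v T) = t * (a \<bullet> (R *\<^sub>v u))"
    using TGR transpose_form[OF mult_carrier_mat[OF G R(1)] u' TZ(1)] by simp
  have "C\<^sup>T * G\<^sup>T = (G * C)\<^sup>T" using transpose_mult[OF G C] by simp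
  then have ZCG: "Z \<bullet> ((C\<^sup>T * G\<^sup>T) *\<^sub>v T) = t * (w * (a \<bullet> cN))"
    using TGC transpose_form[OF mult_carrier_mat[OF G C] TZ(2,1)] by simp
  have Qu: "u \<bullet> (Q *\<^sub>v u) =
      (\<Sum>j\<in>J. \<tau> j * (component n M J j u \<bullet> (P j *\<^sub>v component n M J j u)))"
  proof -
    have "u \<bullet> (Q *\<^sub>v u) = (\<Sum>j\<in>J. u \<bullet> ((\<tau> j \<cdot>\<^sub>m P_nbr n M J P j) *\<^sub>v u))"
      unfolding Q_def d_def using P_nbr_carrier[OF J] u by (intro sum_mat_quadratic_form) auto
    also have "\<dots> = (\<Sum>j\<in>J. \<tau> j * (u \<bullet> (P_nbr n M J P j *\<^sub>v u)))"
    proof (intro sum.cong refl)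
      fix j
      note Pc = P_nbr_carrier[OF J, of n P j]
      have "(\<tau> j \<cdot>\<^sub>m P_nbr n M J P j) *\<^sub>v u = \<tau> j \<cdot>\<^sub>v (P_nbr n M J P j *\<^sub>v u)"
        using Pc u by (intro eq_vecI) (auto simp: scalar_prod_def sum_distrib_left mult.assoc)
      then show "u \<bullet> ((\<tau> j \<cdot>\<^sub>m P_nbr n M J P j) *\<^sub>v u) = \<tau> j * (u \<bullet> (P_nbr n M J P j *\<^sub>v u))"
        using mult_mat_vec_carrier[OF Pc u] u by simp
    qed
    finally show ?thesis using P_nbr_quadratic_form[of J M _ P n u] J P u by simp
  qed
  have T11: "T \<bullet> ((b \<cdot>\<^sub>m 1\<^sub>m 1) *\<^sub>v T) = b * t\<^sup>2"
    by (simp add: T_dot scalar_prod_def) (simp add: T_def power2_eq_square)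
  have Z33: "Z \<bullet> (((b - (\<Sum>j\<in>J. \<tau> j)) \<cdot>\<^sub>m 1\<^sub>m 1) *\<^sub>v Z) = (b - (\<Sum>j\<in>J. \<tau> j)) * w\<^sup>2"
    by (simp add: Z_dot scalar_prod_def) (simp add: Z_def power2_eq_square)
  have "0\<^sub>m d 1 *\<^sub>v Z = 0\<^sub>v d" "0\<^sub>m 1 d *\<^sub>v u = 0\<^sub>v 1" using u' TZ by (auto intro!: eq_vecI)
  then have u0: "u \<bullet> (0\<^sub>m d 1 *\<^sub>v Z) = 0" and Z0: "Z \<bullet> (0\<^sub>m 1 d *\<^sub>v u) = 0"
    using u' TZ by simp_all
  have carriers: "b \<cdot>\<^sub>m 1\<^sub>m 1 \<in> carrier_mat 1 1" "G * R \<in> carrier_mat 1 d" "G * C \<in> carrier_mat 1 1"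
      "R * G\<^sup>T \<in> carrier_mat d 1" "Q \<in> carrier_mat d d" "0\<^sub>m d 1 \<in> carrier_mat d 1"
      "C\<^sup>T * G\<^sup>T \<in> carrier_mat 1 1" "0\<^sub>m 1 d \<in> carrier_mat 1 d"
      "(b - (\<Sum>j\<in>J. \<tau> j)) \<cdot>\<^sub>m 1\<^sub>m 1 \<in> carrier_mat 1 1"
    using G C R Q by auto
  have "lmi_mat n M J P c \<alpha> a b \<tau> =
      three_block_mat (b \<cdot>\<^sub>m 1\<^sub>m 1) (G * R) (G * C) (R * G\<^sup>T) Q (0\<^sub>m d 1) (C\<^sup>T * G\<^sup>T) (0\<^sub>m 1 d)
        ((b - (\<Sum>j\<in>J. \<tau> j)) \<cdot>\<^sub>m 1\<^sub>m 1)"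
    by (simp add: lmi_mat_def Let_def G_def R_def C_def Q_def cN_def d_def)
  then have "v \<bullet> (lmi_mat n M J P c \<alpha> a b \<tau> *\<^sub>v v) =
      b * t\<^sup>2 + t * (a \<bullet> (R *\<^sub>v u)) + t * (w * (a \<bullet> cN)) + t * (a \<bullet> (R *\<^sub>v u)) +
      u \<bullet> (Q *\<^sub>v u) + 0 + t * (w * (a \<bullet> cN)) + 0 + (b - (\<Sum>j\<in>J. \<tau> j)) * w\<^sup>2"
    unfolding v_def T_def[symmetric] Z_def[symmetric]
    by (simp only: three_block_mat_quadratic_form[OF carriers TZ(1) u' TZ(2)] T11 TGR TGC uRG u0 ZCG Z0 Z33)
  then show ?thesis unfolding Qu R_def cN_def by simp
qed

subsection \<open>Scaling the ellipsoids to unit size\<close>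

lemma ellipsoid_scaling:
  assumes J: "J \<subseteq> {..<M}" and P: "\<And>j. j \<in> J \<Longrightarrow> pos_def_mat (n j) (P j)"
    and c: "\<And>j. j < M \<Longrightarrow> c j \<in> carrier_vec (n j)" and \<alpha>: "\<And>j. j \<in> J \<Longrightarrow> \<alpha> j \<ge> 0"
    and x: "x \<in> carrier_vec (total_dim n J)"
    and el: "\<And>j. j \<in> J \<Longrightarrow> component n M J j x \<in> ellipsoid (n j) (P j) (c j) (\<alpha> j)"
  obtains s where "s \<in> carrier_vec (total_dim n J)"
    "x = c_nbr n M J c + \<alpha>_nbr_sqrt n M J \<alpha> *\<^sub>v s"
    "\<forall>j\<in>J. component n M J j s \<bullet> (P j *\<^sub>v component n M J j s) \<le> 1"
proof
  define d where "d = total_dim n J"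
  define R where "R = \<alpha>_nbr_sqrt n M J \<alpha>"
  define y where "y = x - c_nbr n M J c"
  text \<open>Entries with \<open>\<alpha>\<^sub>j = 0\<close> become 0, since division by 0 gives 0.\<close>
  define s where "s = vec d (\<lambda>r. y $ r / R $$ (r, r))"
  have s: "s \<in> carrier_vec (total_dim n J)" by (simp add: s_def d_def)
  have y: "y \<in> carrier_vec (total_dim n J)" using x c_nbr_carrier[OF J] by (simp add: y_def)
  have s_index: "s $ r = y $ r / sqrt (\<alpha> j)" if "nbr_pos n J j k r" for j k r
    using that \<alpha>_nbr_sqrt_index[OF J that, of r] by (simp add: s_def d_def R_def nbr_pos_def)
  have cj: "c j \<in> carrier_vec (n j)" if "j \<in> J" for j using c J that by auto
  have comp_y: "component n M J j y = component n M J j x - c j" if j: "j \<in> J" for j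
  proof (rule eq_vecI)
    fix k assume "k < dim_vec (component n M J j x - c j)"
    then have "k < n j" using cj[OF j] by simp
    then obtain r where r: "nbr_pos n J j k r" using ex_nbr_pos[OF J j] by blast
    then have "r < total_dim n J" by (simp add: nbr_pos_def)
    then show "component n M J j y $ k = (component n M J j x - c j) $ k"
      using \<open>k < n j\<close> cj[OF j] x c_nbr_carrier[OF J, of n c] c_nbr_index[OF J r c]
      by (simp add: component_index[OF J r x] component_index[OF J r y]) (simp add: y_def)
  qed (use component_carrier[OF J j, of n] cj[OF j] in \<open>auto dest!: carrier_vecD\<close>)
  have form_y: "component n M J j y \<bullet> (P j *\<^sub>v component n M J j y) \<le> \<alpha> j" if "j \<in> J" for j
    using el[OF that] comp_y[OF that] by (simp add: ellipsoid_def)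
  \<comment> \<open>For size 0 the form is at most 0, while definiteness makes it positive at every
    nonzero vector.\<close>
  have comp_y_0: "component n M J j y = 0\<^sub>v (n j)" if j: "j \<in> J" and 0: "\<alpha> j = 0" for j
    using form_y[OF j] P[OF j] component_carrier[OF J j, of n y] 0 unfolding pos_def_mat_def
    by force
  \<comment> \<open>If \<open>\<alpha> j = 0\<close>, the right side vanishes whatever the value of
    s, and the left side vanishes by \<open>comp_y_0\<close>; so the division in \<open>s\<close> is
    undone in this case too.\<close>
  have y_index: "y $ r = sqrt (\<alpha> j) * s $ r" if r: "nbr_pos n J j k r" for j k r
  proof (cases "\<alpha> j = 0")
    case True
    have "y $ r = 0"
      using component_index[OF J r y] comp_y_0[OF _ True] r by (simp add: nbr_pos_def)
    then show ?thesis using True by simp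
  next
    case False
    then show ?thesis using s_index[OF r] by simp
  qed
  have comp_s: "component n M J j y = sqrt (\<alpha> j) \<cdot>\<^sub>v component n M J j s" if j: "j \<in> J" for j
  proof (rule eq_vecI)
    fix k assume "k < dim_vec (sqrt (\<alpha> j) \<cdot>\<^sub>v component n M J j s)"
    then have k: "k < n j" "k < dim_vec (component n M J j s)"
      using component_carrier[OF J j, of n s] by auto
    then obtain r where r: "nbr_pos n J j k r" using ex_nbr_pos[OF J j] by blast
    show "component n M J j y $ k = (sqrt (\<alpha> j) \<cdot>\<^sub>v component n M J j s) $ k"
      using k y_index[OF r] by (simp add: component_index[OF J r y] component_index[OF J r s])
  qed (use component_carrier[OF J j, of n y] component_carrier[OF J j, of n s] in simp)
  show "s \<in> carrier_vec (total_dim n J)" by (rule s)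
  show "x = c_nbr n M J c + \<alpha>_nbr_sqrt n M J \<alpha> *\<^sub>v s"
  proof (rule eq_vecI)
    note R = \<alpha>_nbr_sqrt_carrier[OF J, of n \<alpha>]
    fix r assume "r < dim_vec (c_nbr n M J c + \<alpha>_nbr_sqrt n M J \<alpha> *\<^sub>v s)"
    then have r: "r < total_dim n J" using R by simp
    obtain j k where jk: "nbr_pos n J j k r" using nbr_pos_cases[OF J r] .
    have "(c_nbr n M J c + \<alpha>_nbr_sqrt n M J \<alpha> *\<^sub>v s) $ r = c_nbr n M J c $ r + y $ r"
      using r R y_index[OF jk] \<alpha>_nbr_sqrt_mult_vec[OF J jk s]
      by (simp del: index_mult_mat_vec)
    then show "x $ r = (c_nbr n M J c + \<alpha>_nbr_sqrt n M J \<alpha> *\<^sub>v s) $ r"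
      using r x c_nbr_carrier[OF J, of n c] by (simp add: y_def)
  qed (use x \<alpha>_nbr_sqrt_carrier[OF J, of n \<alpha>] in auto)
  show "\<forall>j\<in>J. component n M J j s \<bullet> (P j *\<^sub>v component n M J j s) \<le> 1"
  proof
    fix j assume j: "j \<in> J"
    have Pj: "P j \<in> carrier_mat (n j) (n j)" using P[OF j] by (simp add: pos_def_mat_def)
    note cs = component_carrier[OF J j, of n s]
    show "component n M J j s \<bullet> (P j *\<^sub>v component n M J j s) \<le> 1"
    proof (cases "\<alpha> j = 0")
      case True
      \<comment> \<open>The entries of s in this block are quotients by \<open>sqrt 0\<close>, hence
        0, and the form takes the value 0, which is at most 1.\<close>
      have "component n M J j s = 0\<^sub>v (n j)"
      proof (rule eq_vecI)
        fix k assume "k < dim_vec (0\<^sub>v (n j) :: real vec)"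
        then have k: "k < n j" by simp
        then obtain r where r: "nbr_pos n J j k r" using ex_nbr_pos[OF J j] by blast
        show "component n M J j s $ k = 0\<^sub>v (n j) $ k"
          using component_index[OF J r s] s_index[OF r] True k by simp
      qed (use cs in auto)
      then show ?thesis using Pj by simp
    next
      case False
      then have pos: "\<alpha> j > 0" using \<alpha>[OF j] by simp
      \<comment> \<open>Both arguments of the form contribute a factor
        \<open>sqrt (\<alpha> j)\<close>. Dividing the ellipsoid bound by
        \<open>\<alpha> j > 0\<close> leaves the bound 1.\<close>
      have "component n M J j y \<bullet> (P j *\<^sub>v component n M J j y) =
          sqrt (\<alpha> j) * (sqrt (\<alpha> j) * (component n M J j s \<bullet> (P j *\<^sub>v component n M J j s)))"
        using cs mult_mat_vec_carrier[OF Pj cs] unfolding comp_s[OF j]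
        by (simp add: mult_mat_vec[OF Pj cs])
      also have "\<dots> = \<alpha> j * (component n M J j s \<bullet> (P j *\<^sub>v component n M J j s))"
        using pos by (simp flip: mult.assoc)
      finally show ?thesis using form_y[OF j] pos by simp
    qed
  qed
qed

section \<open>The S-procedure argument for one constraint row\<close>

theorem proposition3:
  fixes M i k :: nat
    and n q :: "nat \<Rightarrow> nat"
    and N :: "nat \<Rightarrow> nat set"
    and P G :: "nat \<Rightarrow> real mat"
    and g c :: "nat \<Rightarrow> real vec"
    and \<alpha> :: "nat \<Rightarrow> real"
  assumes "\<And>l. l < M \<Longrightarrow> N l \<subseteq> {..<M}"
    and "\<And>l. l < M \<Longrightarrow> l \<in> N l"
    and "\<And>j. j < M \<Longrightarrow> pos_def_mat (n j) (P j)"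
    and "\<And>l. l < M \<Longrightarrow> G l \<in> carrier_mat (q l) (total_dim n (N l))"
    and "\<And>l. l < M \<Longrightarrow> g l \<in> carrier_vec (q l)"
    and "\<And>l. l < M \<Longrightarrow> 0\<^sub>v (total_dim n (N l)) \<in>
           interior_vec (total_dim n (N l)) (polyhedron (total_dim n (N l)) (G l) (g l))"
    and "i < M"
    and "k < q i"
    and "\<And>j. j < M \<Longrightarrow> c j \<in> carrier_vec (n j)"
    and "\<And>j. j < M \<Longrightarrow> \<alpha> j \<ge> 0"
    and "\<exists>\<tau> :: nat \<Rightarrow> real. (\<forall>j \<in> N i. \<tau> j \<ge> 0) \<and>
           pos_semidef_mat (1 + total_dim n (N i) + 1)
             (lmi_mat n M (N i) P c \<alpha> (row (G i) k) (g i $ k) \<tau>)"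
  shows "\<forall>x \<in> carrier_vec (total_dim n (N i)).
           (\<forall>j \<in> N i. component n M (N i) j x \<in> ellipsoid (n j) (P j) (c j) (\<alpha> j)) \<longrightarrow>
           row (G i) k \<bullet> x \<le> g i $ k"
proof (intro ballI impI)
  fix x assume x: "x \<in> carrier_vec (total_dim n (N i))"
    and el: "\<forall>j \<in> N i. component n M (N i) j x \<in> ellipsoid (n j) (P j) (c j) (\<alpha> j)"
  define a where "a = row (G i) k"
  define b where "b = g i $ k"
  have J: "N i \<subseteq> {..<M}" using assms(1,7) by blast
  have P: "pos_def_mat (n j) (P j)" if "j \<in> N i" for j using assms(3) J that by auto
  have a: "a \<in> carrier_vec (total_dim n (N i))" using assms(4)[OF assms(7)] by (auto simp: a_def intro!: carrier_vecI)
  obtain \<tau> where \<tau>: "\<And>j. j \<in> N i \<Longrightarrow> \<tau> j \<ge> 0" and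
    psd: "pos_semidef_mat (1 + total_dim n (N i) + 1) (lmi_mat n M (N i) P c \<alpha> a b \<tau>)"
    using assms(11) unfolding a_def b_def by blast
  have \<alpha>: "\<alpha> j \<ge> 0" if "j \<in> N i" for j using assms(10) J that by auto
  obtain s where s: "s \<in> carrier_vec (total_dim n (N i))"
    and x_eq: "x = c_nbr n M (N i) c + \<alpha>_nbr_sqrt n M (N i) \<alpha> *\<^sub>v s"
    and le: "\<forall>j\<in>N i. component n M (N i) j s \<bullet> (P j *\<^sub>v component n M (N i) j s) \<le> 1"
    by (rule ellipsoid_scaling[where n = n and P = P and c = c and \<alpha> = \<alpha>,
          OF J P assms(9) \<alpha> x el[rule_format]])
  \<comment> \<open>The two outer entries have square 1, so the corner blocks give 2 b minus the sum
    of the multipliers. Their opposite signs make both cross terms negative, and together these are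
    -2 times \<open>a \<bullet> x\<close>.\<close>
  define v where "v = vec 1 (\<lambda>_. -1) @\<^sub>v s @\<^sub>v vec 1 (\<lambda>_. 1 :: real)"
  have "v \<in> carrier_vec (1 + total_dim n (N i) + 1)" using s by (intro carrier_vecI) (simp add: v_def)
  then have "0 \<le> v \<bullet> (lmi_mat n M (N i) P c \<alpha> a b \<tau> *\<^sub>v v)"
    using psd by (simp add: pos_semidef_mat_def)
  also have "\<dots> = 2 * b - 2 * (a \<bullet> (\<alpha>_nbr_sqrt n M (N i) \<alpha> *\<^sub>v s)) - 2 * (a \<bullet> c_nbr n M (N i) c) +
      (\<Sum>j\<in>N i. \<tau> j * (component n M (N i) j s \<bullet> (P j *\<^sub>v component n M (N i) j s))) -
      (\<Sum>j\<in>N i. \<tau> j)"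
    unfolding v_def using P by (subst lmi_mat_quadratic_form[OF J _ a s]) (auto simp: pos_def_mat_def)
  \<comment> \<open>Multipliers are nonnegative and each form is at most 1, so this sum is absorbed
    by the subtracted sum of the multipliers.\<close>
  also have "(\<Sum>j\<in>N i. \<tau> j * (component n M (N i) j s \<bullet> (P j *\<^sub>v component n M (N i) j s)))
      \<le> (\<Sum>j\<in>N i. \<tau> j)"
    using \<tau> le by (intro sum_mono) (simp add: mult_left_le)
  finally have "a \<bullet> c_nbr n M (N i) c + a \<bullet> (\<alpha>_nbr_sqrt n M (N i) \<alpha> *\<^sub>v s) \<le> b" by simp
  moreover have "a \<bullet> x =
      a \<bullet> c_nbr n M (N i) c + a \<bullet> (\<alpha>_nbr_sqrt n M (N i) \<alpha> *\<^sub>v s)"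
    unfolding x_eq using a c_nbr_carrier[OF J] mult_mat_vec_carrier[OF \<alpha>_nbr_sqrt_carrier[OF J] s]
    by (intro scalar_prod_add_distrib)
  ultimately show "row (G i) k \<bullet> x \<le> g i $ k" by (simp add: a_def b_def)
qed

end
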